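(* Let $n\ge 2$ and let $m=(m_1,\dots,m_n)$ be an $n$-tuple of positive integers with $m_1=1$; let $x_1>0$ and $x_i=1$ for $2\le i\le n$. Consider the continuous-time Markov chain on the set $\Omega^{FM}_m$ of multiline queues of type $m$ in which, for each column $i$, the ringing path transition at $i$ is performed on the current state $\mathcal Q$ at rate $x_1$ if $B(\mathcal Q)_i=1$, and at rate $1$ if $B(\mathcal Q)_i\in\{2,\dots,n\}$, where $B$ is the bully-path projection. Then the stationary probability of $\mathcal Q\in\Omega^{FM}_m$ is $$w(\mathcal Q)=\frac{x_1^{\,v_1-z_1(\mathcal Q)}}{Z_m},$$ where $v_1$ is the total number of $\circ$'s below row 1, $z_1(\mathcal Q)$ is the total number of 1-covered $\circ$'s in $\mathcal Q$, and $Z_m$ is the normalizing partition function $Z_m=\sum_{\mathcal Q\in\Omega^{FM}_m}x_1^{\,v_1-z_1(\mathcal Q)}$.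
   Context: Let $N=m_1+\dots+m_n$ and $M_r=m_1+\dots+m_r$. Columns (sites) are indexed by $\mathbb Z/N\mathbb Z$, and "left"/"right" are cyclic. **Multiline queues.** $\Omega^{FM}_m$ is the set of arrays $\mathcal Q=(\mathcal Q_{r,i})$, $1\le r\le n-1$, $i\in\mathbb Z/N\mathbb Z$, with entries in $\{\circ,\bullet\}$ ($\circ$ = vacant, $\bullet$ = occupied), such that row $r$ has exactly $M_r$ $\bullet$'s. Rows are numbered from the top. The number of $\circ$'s below row 1 is $v_1=\sum_{r=2}^{n-1}(N-M_r)$. **Bully-path projection $B$.** It maps $\mathcal Q$ to a word $B(\mathcal Q)\in\{1,\dots,n\}^N$ having $m_j$ letters $j$ for each $j$. All $\bullet$'s of row 1 have class 1. Given the classes $1,\dots,r$ of the $\bullet$'s in row $r$, classify row $r+1$ as follows: process the $\bullet$'s of row $r$ in order of increasing class (in any order within a class). For a $\bullet$ of class $k$ at $(r,i)$, find the first column $i'$ in the cyclic sequence $i,i+1,i+2,\dots$ such that $(r+1,i')$ contains a not yet classified $\bullet$, and give that $\bullet$ class $k$; the bully path of the particle goes from $(r,i)$ to $(r+1,i)$ and then through $(r+1,i+1),\dots,(r+1,i')$, and continues downward from there. The $m_{r+1}$ $\bullet$'s of row $r+1$ left unclassified get class $r+1$. Finally $B(\mathcal Q)_i$ is the class of the $\bullet$ at $(n-1,i)$, or $n$ if $(n-1,i)$ is vacant. The classes do not depend on the order of processing within a class. **1-covered vacancies.** A $\circ$ is 1-covered if it is traversed by the bully path of a class 1 particle (here there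 is exactly one such path since $m_1=1$). $z_{r,1}(\mathcal Q)$ is the number of 1-covered $\circ$'s in row $r$, and $z_1(\mathcal Q)=\sum_{r=2}^{n-1}z_{r,1}(\mathcal Q)$. **Ringing path transitions.** For $\mathcal Q\in\Omega^{FM}_m$ and a column $i$, define $P_{n-1}=i$ and, for $r=n-1,\dots,2$, $P_{r-1}=P_r$ if $\mathcal Q_{r,P_r}=\bullet$, and $P_{r-1}=P_r+1 \pmod N$ if $\mathcal Q_{r,P_r}=\circ$. The ringing path transition at $i$ does the following simultaneously for every row $r$: if $\mathcal Q_{r,P_r-1}=\circ$ and $\mathcal Q_{r,P_r}=\bullet$, these two entries are interchanged; otherwise row $r$ is unchanged. (Transitions that do not change the state are ignored.) *)

theory Defs
  imports Complex_Main
begin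

section \<open>Multiline queues\<close>

text \<open>
  A two-valued array is represented by the set of its occupied positions \<open>(r, i)\<close>, with row
  \<open>r\<close> counted from the top starting at 1 and column \<open>i\<close> in \<open>{..<N}\<close>. Columns are read modulo \<open>N\<close>,
  so \<open>(i + d) mod N\<close> is the column \<open>d\<close> steps to the right of \<open>i\<close>.
\<close>

type_synonym mlq = "(nat \<times> nat) set"

definition partial_size :: "(nat \<Rightarrow> nat) \<Rightarrow> nat \<Rightarrow> nat" where
  "partial_size m r = (\<Sum>j = 1..r. m j)"

definition row :: "mlq \<Rightarrow> nat \<Rightarrow> nat set" where
  "row Q r = {i. (r, i) \<in> Q}"

definition mlqs :: "nat \<Rightarrow> (nat \<Rightarrow> nat) \<Rightarrow> mlq set" where
  "mlqs n m = {Q. Q \<subseteq> {1..n - 1} \<times> {..<partial_size m n} \<and>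
                  (\<forall>r \<in> {1..n - 1}. card (row Q r) = partial_size m r)}"


section \<open>Bully paths and the projection\<close>

text \<open>
  \<open>bully_match N is A\<close> lets the particles in the columns \<open>is\<close> of one row choose, in the order of
  the list, particles of the next row, whose not yet classified particles are in the columns \<open>A\<close>.
  A pair \<open>(i, d)\<close> in the result means that the bully path starting in column \<open>i\<close> passes through
  the columns \<open>i, i + 1, \<dots>, i + d\<close> of the next row and ends at the particle in column \<open>i + d\<close>.
\<close>

fun bully_match :: "nat \<Rightarrow> nat list \<Rightarrow> nat set \<Rightarrow> (nat \<times> nat) list" where
  "bully_match N [] A = []"
| "bully_match N (i # is) A =
     (let d = (LEAST d. (i + d) mod N \<in> A)
      in (i, d) # bully_match N is (A - {(i + d) mod N}))"

text \<open>
  The classes in a row are a partial map from columns, defined on the occupied ones. Particles are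
  processed by increasing class and, within a class, by increasing column; the resulting classes
  are the same for every order within a class.
\<close>

definition bully_moves :: "nat \<Rightarrow> (nat \<rightharpoonup> nat) \<Rightarrow> nat set \<Rightarrow> (nat \<times> nat) list" where
  "bully_moves N c A =
     bully_match N (sort_key (\<lambda>i. the (c i)) (sorted_list_of_set (dom c))) A"

text \<open>
  The recursion starts from a fictitious empty row 0, so that every particle of row 1 is left
  unclassified by the row above and gets class 1.
\<close>

primrec classes :: "nat \<Rightarrow> mlq \<Rightarrow> nat \<Rightarrow> (nat \<rightharpoonup> nat)" where
  "classes N Q 0 = Map.empty"
| "classes N Q (Suc r) =
     (\<lambda>j. if j \<in> row Q (Suc r) then Some (Suc r) else None) ++
     map_of (map (\<lambda>(i, d). ((i + d) mod N, the (classes N Q r i)))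
                 (bully_moves N (classes N Q r) (row Q (Suc r))))"

definition bully_projection :: "nat \<Rightarrow> (nat \<Rightarrow> nat) \<Rightarrow> mlq \<Rightarrow> nat \<Rightarrow> nat" where
  "bully_projection n m Q i =
     (case classes (partial_size m n) Q (n - 1) i of Some k \<Rightarrow> k | None \<Rightarrow> n)"


section \<open>1-covered vacancies\<close>

definition covered_vacancies :: "nat \<Rightarrow> mlq \<Rightarrow> nat \<Rightarrow> nat set" where
  "covered_vacancies N Q r =
     {j. j \<notin> row Q r \<and>
         (\<exists>i d e. (i, d) \<in> set (bully_moves N (classes N Q (r - 1)) (row Q r)) \<and>
                  classes N Q (r - 1) i = Some 1 \<and> e \<le> d \<and> j = (i + e) mod N)}"

definition z_one :: "nat \<Rightarrow> (nat \<Rightarrow> nat) \<Rightarrow> mlq \<Rightarrow> nat" where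
  "z_one n m Q = (\<Sum>r = 2..n - 1. card (covered_vacancies (partial_size m n) Q r))"

definition v_one :: "nat \<Rightarrow> (nat \<Rightarrow> nat) \<Rightarrow> nat" where
  "v_one n m = (\<Sum>r = 2..n - 1. partial_size m n - partial_size m r)"

text \<open>
  The truncated subtractions are harmless: \<open>z_one n m Q\<close> counts some of the \<open>v_one n m\<close>
  vacancies below row 1.
\<close>

definition mlq_weight :: "nat \<Rightarrow> (nat \<Rightarrow> nat) \<Rightarrow> real \<Rightarrow> mlq \<Rightarrow> real" where
  "mlq_weight n m x1 Q = x1 ^ (v_one n m - z_one n m Q)"

definition partition_function :: "nat \<Rightarrow> (nat \<Rightarrow> nat) \<Rightarrow> real \<Rightarrow> real" where
  "partition_function n m x1 = (\<Sum>Q \<in> mlqs n m. mlq_weight n m x1 Q)"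


section \<open>Ringing path transitions\<close>

text \<open>\<open>ring_pos n N Q i r\<close> is the position in row \<open>r\<close> of the ringing path started at column \<open>i\<close>.\<close>

function ring_pos :: "nat \<Rightarrow> nat \<Rightarrow> mlq \<Rightarrow> nat \<Rightarrow> nat \<Rightarrow> nat" where
  "ring_pos n N Q i r =
     (if r < n - 1
      then let p = ring_pos n N Q i (Suc r) in if (Suc r, p) \<in> Q then p else (p + 1) mod N
      else i)"
  by pat_completeness auto
termination by (relation "measure (\<lambda>(n, N, Q, i, r). n - 1 - r)") auto

declare ring_pos.simps [simp del]

definition left_of :: "nat \<Rightarrow> nat \<Rightarrow> nat" where
  "left_of N p = (p + N - 1) mod N"

definition ring_rows :: "nat \<Rightarrow> nat \<Rightarrow> mlq \<Rightarrow> nat \<Rightarrow> nat set" where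
  "ring_rows n N Q i =
     {r \<in> {1..n - 1}. (r, left_of N (ring_pos n N Q i r)) \<notin> Q \<and> (r, ring_pos n N Q i r) \<in> Q}"

definition ring_transition :: "nat \<Rightarrow> nat \<Rightarrow> mlq \<Rightarrow> nat \<Rightarrow> mlq" where
  "ring_transition n N Q i =
     (Q - (\<lambda>r. (r, ring_pos n N Q i r)) ` ring_rows n N Q i)
     \<union> (\<lambda>r. (r, left_of N (ring_pos n N Q i r))) ` ring_rows n N Q i"

text \<open>Different columns may induce the same transition; their rates add up.\<close>

definition ring_rate :: "nat \<Rightarrow> (nat \<Rightarrow> nat) \<Rightarrow> (nat \<Rightarrow> real) \<Rightarrow> mlq \<Rightarrow> mlq \<Rightarrow> real" where
  "ring_rate n m x Q Q' =
     (\<Sum>i \<in> {i \<in> {..<partial_size m n}. ring_transition n (partial_size m n) Q i = Q'}.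
        x (bully_projection n m Q i))"


section \<open>Finite continuous-time Markov chains\<close>

text \<open>
  The generator (Q-matrix) on the finite state space \<open>S\<close> with off-diagonal jump rates \<open>q\<close>;
  the values \<open>q s s\<close> are ignored.
\<close>

definition generator :: "'s set \<Rightarrow> ('s \<Rightarrow> 's \<Rightarrow> real) \<Rightarrow> 's \<Rightarrow> 's \<Rightarrow> real" where
  "generator S q s t = (if s = t then - (\<Sum>u \<in> S - {s}. q s u) else q s t)"

definition stationary_distribution ::
    "'s set \<Rightarrow> ('s \<Rightarrow> 's \<Rightarrow> real) \<Rightarrow> ('s \<Rightarrow> real) \<Rightarrow> bool" where
  "stationary_distribution S q p \<longleftrightarrow>
     (\<forall>s \<in> S. 0 \<le> p s) \<and> (\<Sum>s \<in> S. p s) = 1 \<and>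
     (\<forall>t \<in> S. (\<Sum>s \<in> S. p s * generator S q s t) = 0)"

end

theory Submission
  imports Defs
begin

text \<open>
  The proof has two halves: the claimed weights are balanced, and the chain is connected.

  For the balance, follow the ringing path one row further, to a column \<open>P\<^sub>0\<close> above row 1. Passing
  a row with path position \<open>p\<close> changes the row and produces the path position in the next row
  up, and both the old row and \<open>p\<close> can be recovered from the new row and the new position.
  Therefore \<open>(Q, i) \<mapsto> (Q', P\<^sub>0)\<close> is a bijection (\<open>bij_betw_ring\<close>): every state \<open>Q'\<close> has exactly
  one incoming transition for each value of \<open>P\<^sub>0\<close>. Let \<open>c\<^sub>r\<close> be the column of the class 1
  particle in row \<open>r\<close> and \<open>P\<^sub>r\<close> the position of the ringing path there. The column \<open>c\<^sub>r\<close> moves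
  one step to the left if \<open>P\<^sub>r = c\<^sub>r\<close> and stays in place otherwise, and
  the number of 1-covered vacancies in row \<open>r\<close> changes by \<open>[P\<^sub>r\<^sub>-\<^sub>1 = c\<^sub>r\<^sub>-\<^sub>1] - [P\<^sub>r = c\<^sub>r]\<close>. The sum over
  the rows telescopes (\<open>z_one_ring_transition\<close>), so the weight of \<open>Q\<close> times the rate of ringing
  column \<open>i\<close> equals the weight of \<open>Q'\<close> times \<open>x\<^sub>1\<close> or 1, with \<open>x\<^sub>1\<close> exactly when \<open>P\<^sub>1 = c\<^sub>1\<close>.
  In terms of the image this condition says that \<open>P\<^sub>0\<close> is one particular column depending on \<open>Q'\<close>,
  so the inflow into \<open>Q'\<close> is its weight times \<open>x\<^sub>1 + N - 1\<close>, which is also the outflow.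

  For uniqueness, a second balanced \<open>p\<close> has constant ratio \<open>p / w\<close> along every jump, because
  its Dirichlet form with respect to the flow of \<open>w\<close> vanishes. It then suffices to reach one fixed
  state from every state. If column 0 is never rung, the particles of the bottom row pile up in a block
  starting at column 0. A ringing path through a block that starts in column \<open>s\<close> and has \<open>M\<close>
  particles, and that does not hit column \<open>s\<close>, leaves the block intact and can exit in every column
  except \<open>s + M\<close>.
  The next row up is thus never rung in column \<open>s + M\<close>, its particles pile up in a block starting
  there, and so on to the top (\<open>constant_if_ring_invariant\<close>).
\<close>

section \<open>Stationary distributions of finite chains\<close>

text \<open>
  The two terms with \<open>q t t\<close> on the right-hand side cancel, so that transitions which keep the state
  can be counted among the jumps in the balance equations.
\<close>

lemma sum_generator:
  assumes "finite S" "t \<in> S"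
  shows "(\<Sum>s\<in>S. p s * generator S q s t) = (\<Sum>s\<in>S. p s * q s t) - p t * (\<Sum>u\<in>S. q t u)"
proof -
  have "(\<Sum>s\<in>S. p s * generator S q s t) =
      p t * generator S q t t + (\<Sum>s\<in>S - {t}. p s * generator S q s t)"
    using assms by (simp add: sum.remove)
  also have "(\<Sum>s\<in>S - {t}. p s * generator S q s t) = (\<Sum>s\<in>S - {t}. p s * q s t)"
    by (rule sum.cong) (auto simp: generator_def)
  finally show ?thesis
    using assms by (simp add: sum.remove[where x = t] generator_def algebra_simps)
qed

text \<open>
  With \<open>h = p / w\<close>, expanding the square in \<open>\<Sum> w s * q s t * (h s - h t)\<^sup>2\<close> and using the two
  balance equations gives \<open>E + E - 2 * E = 0\<close>, where \<open>E\<close> is the sum of \<open>h\<^sup>2\<close> weighted by the total flow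
  of \<open>w\<close> out of each state. Every term is nonnegative, hence zero.
\<close>

lemma balanced_ratio_eq_along_jump:
  fixes q :: "'s \<Rightarrow> 's \<Rightarrow> real"
  assumes fin: "finite S"
    and q: "\<And>s t. s \<in> S \<Longrightarrow> t \<in> S \<Longrightarrow> 0 \<le> q s t"
    and w: "\<And>s. s \<in> S \<Longrightarrow> 0 < w s"
    and bal_w: "\<And>t. t \<in> S \<Longrightarrow> (\<Sum>s\<in>S. w s * q s t) = w t * (\<Sum>u\<in>S. q t u)"
    and bal_p: "\<And>t. t \<in> S \<Longrightarrow> (\<Sum>s\<in>S. p s * q s t) = p t * (\<Sum>u\<in>S. q t u)"
    and st: "s \<in> S" "t \<in> S" "0 < q s t"
  shows "p s / w s = p t / w t"
proof -
  define h where "h s = p s / w s" for s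
  define out where "out s = (\<Sum>u\<in>S. q s u)" for s
  have p: "p s = w s * h s" if "s \<in> S" for s
    using w[OF that] by (simp add: h_def)
  define E where "E = (\<Sum>s\<in>S. w s * (h s)\<^sup>2 * out s)"
  have E1: "(\<Sum>s\<in>S. \<Sum>t\<in>S. w s * q s t * (h s)\<^sup>2) = E"
    unfolding E_def out_def by (simp add: sum_distrib_left sum_distrib_right mult_ac)
  have "(\<Sum>s\<in>S. \<Sum>t\<in>S. w s * q s t * (h t)\<^sup>2) = (\<Sum>t\<in>S. (h t)\<^sup>2 * (\<Sum>s\<in>S. w s * q s t))"
    by (subst sum.swap) (simp add: sum_distrib_left mult_ac)
  also have "\<dots> = E"
    unfolding E_def by (rule sum.cong) (simp_all add: bal_w out_def)
  finally have E2: "(\<Sum>s\<in>S. \<Sum>t\<in>S. w s * q s t * (h t)\<^sup>2) = E" .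
  have "(\<Sum>s\<in>S. \<Sum>t\<in>S. w s * q s t * (h s * h t)) = (\<Sum>t\<in>S. h t * (\<Sum>s\<in>S. p s * q s t))"
    by (subst sum.swap) (simp add: sum_distrib_left p mult_ac)
  also have "\<dots> = E"
    unfolding E_def
  proof (rule sum.cong)
    fix t assume "t \<in> S"
    then show "h t * (\<Sum>s\<in>S. p s * q s t) = w t * (h t)\<^sup>2 * out t"
      by (simp only: bal_p out_def) (simp add: p power2_eq_square)
  qed simp
  finally have E3: "(\<Sum>s\<in>S. \<Sum>t\<in>S. w s * q s t * (h s * h t)) = E" .
  have "(\<Sum>s\<in>S. \<Sum>t\<in>S. w s * q s t * (h s - h t)\<^sup>2) =
      (\<Sum>s\<in>S. \<Sum>t\<in>S. w s * q s t * (h s)\<^sup>2 + w s * q s t * (h t)\<^sup>2 - 2 * (w s * q s t * (h s * h t)))"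
    by (intro sum.cong refl) (simp add: power2_eq_square algebra_simps)
  also have "\<dots> = 0"
    by (simp add: sum.distrib sum_subtractf E1 E2 E3 flip: sum_distrib_left)
  finally have zero: "(\<Sum>s\<in>S. \<Sum>t\<in>S. w s * q s t * (h s - h t)\<^sup>2) = 0" .
  have nonneg: "0 \<le> w s * q s t * (h s - h t)\<^sup>2" if "s \<in> S" "t \<in> S" for s t
    using that q w by (simp add: less_imp_le)
  have "(\<Sum>t\<in>S. w s * q s t * (h s - h t)\<^sup>2) = 0"
    using zero st fin by (subst (asm) sum_nonneg_eq_0_iff) (auto intro: sum_nonneg nonneg)
  then have "w s * q s t * (h s - h t)\<^sup>2 = 0"
    using st fin by (subst (asm) sum_nonneg_eq_0_iff) (auto intro: nonneg)
  then show ?thesis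
    using st w[of s] by (simp add: h_def)
qed

text \<open>
  Connectivity is meant in the undirected sense and stated through functions that are constant along
  jumps, as the ratio of two balanced weights is.
\<close>

lemma stationary_distribution_iff_normalized:
  fixes q :: "'s \<Rightarrow> 's \<Rightarrow> real"
  assumes fin: "finite S" and ne: "S \<noteq> {}"
    and q: "\<And>s t. s \<in> S \<Longrightarrow> t \<in> S \<Longrightarrow> 0 \<le> q s t"
    and w: "\<And>s. s \<in> S \<Longrightarrow> 0 < w s"
    and bal: "\<And>t. t \<in> S \<Longrightarrow> (\<Sum>s\<in>S. w s * q s t) = w t * (\<Sum>u\<in>S. q t u)"
    and conn: "\<And>h :: 's \<Rightarrow> real. (\<And>s t. s \<in> S \<Longrightarrow> t \<in> S \<Longrightarrow> 0 < q s t \<Longrightarrow> h s = h t)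
      \<Longrightarrow> \<exists>c. \<forall>s\<in>S. h s = c"
  shows "stationary_distribution S q p \<longleftrightarrow> (\<forall>s\<in>S. p s = w s / (\<Sum>s\<in>S. w s))"
proof
  have Z: "0 < (\<Sum>s\<in>S. w s)"
    using fin ne w by (rule sum_pos)
  show "\<forall>s\<in>S. p s = w s / (\<Sum>s\<in>S. w s)" if p: "stationary_distribution S q p"
  proof -
    have "(\<Sum>s\<in>S. p s * q s t) = p t * (\<Sum>u\<in>S. q t u)" if "t \<in> S" for t
      using p that sum_generator[OF fin that, of p q] by (simp add: stationary_distribution_def)
    then have "\<exists>c. \<forall>s\<in>S. p s / w s = c"
      using balanced_ratio_eq_along_jump[OF fin q w bal] by (intro conn) blast
    then obtain c where c: "\<And>s. s \<in> S \<Longrightarrow> p s / w s = c"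
      by blast
    have pc: "p s = c * w s" if "s \<in> S" for s
      using c[OF that] w[OF that] by (simp add: field_simps)
    then have "(\<Sum>s\<in>S. p s) = c * (\<Sum>s\<in>S. w s)"
      by (simp add: sum_distrib_left)
    then have "c = 1 / (\<Sum>s\<in>S. w s)"
      using p Z by (simp add: stationary_distribution_def field_simps)
    then show ?thesis
      using pc by simp
  qed
  show "stationary_distribution S q p" if p: "\<forall>s\<in>S. p s = w s / (\<Sum>s\<in>S. w s)"
    unfolding stationary_distribution_def
  proof (intro conjI ballI)
    show "0 \<le> p s" if "s \<in> S" for s
      using p that w[OF that] Z by simp
    show "(\<Sum>s\<in>S. p s) = 1"
      using p Z by (simp flip: sum_divide_distrib)
    show "(\<Sum>s\<in>S. p s * generator S q s t) = 0" if t: "t \<in> S" for t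
      using bal[OF t] p t
      by (simp add: sum_generator[OF fin t] flip: sum_divide_distrib)
  qed
qed

section \<open>One row\<close>

lemma left_of_less: "0 < N \<Longrightarrow> left_of N p < N"
  by (simp add: left_of_def)

lemma left_of_Suc_mod: "p < N \<Longrightarrow> left_of N (Suc p mod N) = p"
  by (cases "Suc p = N") (auto simp: left_of_def)

lemma Suc_left_of_mod: "p < N \<Longrightarrow> Suc (left_of N p) mod N = p"
  by (cases p) (auto simp: left_of_def)

lemma add_mod_inject:
  fixes N :: nat
  assumes "(c + d) mod N = (c + e) mod N" "d < N" "e < N"
  shows "d = e"
  using assms
proof (induction d e rule: linorder_wlog)
  case (le d e)
  then have "N dvd (c + e) - (c + d)"
    using mod_eq_dvd_iff_nat[of "c + d" "c + e" N] by simp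
  then show ?case
    using le dvd_imp_le[of N "e - d"] by (cases "d = e") auto
qed auto

lemma ex_offset:
  fixes N :: nat
  assumes "a < N"
  obtains d where "d < N" "(i + d) mod N = a"
proof
  let ?d = "(a + (N - i mod N)) mod N"
  show "?d < N"
    using assms by simp
  have "i mod N < N"
    using assms by simp
  then have "i mod N + (a + (N - i mod N)) = a + N"
    by linarith
  then have "(i mod N + (a + (N - i mod N))) mod N = a"
    using assms by simp
  then show "(i + ?d) mod N = a"
    by (simp add: mod_simps)
qed

text \<open>
  When a ringing path reaches a row with particles \<open>A\<close> at position \<open>p\<close>, it continues in the row above
  at position \<open>ring_exit N A p\<close>, and the row becomes \<open>ring_row N A p\<close>.
\<close>

definition ring_exit :: "nat \<Rightarrow> nat set \<Rightarrow> nat \<Rightarrow> nat" where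
  "ring_exit N A p = (if p \<in> A then p else Suc p mod N)"

definition ring_row :: "nat \<Rightarrow> nat set \<Rightarrow> nat \<Rightarrow> nat set" where
  "ring_row N A p = (if p \<in> A \<and> left_of N p \<notin> A then insert (left_of N p) (A - {p}) else A)"

text \<open>
  The inverse of passing a row. A vacancy left of the exit column \<open>q\<close> can only mean that the path
  hit this vacancy. Otherwise the path entered at \<open>q\<close>, where there was a particle, which has
  jumped to the left if it is no longer there.
\<close>

definition unring_row :: "nat \<Rightarrow> nat set \<Rightarrow> nat \<Rightarrow> nat set \<times> nat" where
  "unring_row N A q =
     (if left_of N q \<notin> A then (A, left_of N q)
      else if q \<in> A then (A, q) else (insert q (A - {left_of N q}), q))"

lemma unring_row_ring_row:
  assumes "p < N"
  shows "unring_row N (ring_row N A p) (ring_exit N A p) = (A, p)"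
  using left_of_Suc_mod[OF assms] by (auto simp: unring_row_def ring_row_def ring_exit_def)

lemma card_ring_row: "finite A \<Longrightarrow> card (ring_row N A p) = card A"
  using card.remove[of A p] by (auto simp: ring_row_def simp del: card_Diff_insert)

lemma ring_exit_less: "p < N \<Longrightarrow> ring_exit N A p < N"
  by (auto simp: ring_exit_def)

text \<open>
  The number of columns that a particle entering a row at column \<open>i\<close> skips before it meets a
  particle of \<open>A\<close>; for the class 1 particle these are the vacancies it covers.
\<close>

definition gap :: "nat \<Rightarrow> nat set \<Rightarrow> nat \<Rightarrow> nat" where
  "gap N A i = (LEAST d. (i + d) mod N \<in> A)"

lemma gap_eqI:
  assumes "(i + d) mod N \<in> A" "\<And>e. e < d \<Longrightarrow> (i + e) mod N \<notin> A"
  shows "gap N A i = d"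
  unfolding gap_def using assms by (intro Least_equality) (auto simp: not_less[symmetric])

lemma not_in_before_gap: "e < gap N A i \<Longrightarrow> (i + e) mod N \<notin> A"
  unfolding gap_def by (rule not_less_Least)

lemma
  assumes A: "A \<subseteq> {..<N}" "A \<noteq> {}" and i: "i < N"
  shows gap_in: "(i + gap N A i) mod N \<in> A"
    and gap_less: "gap N A i < N"
proof -
  obtain a where a: "a \<in> A" "a < N"
    using A by auto
  obtain d where d: "d < N" "(i + d) mod N \<in> A"
    using ex_offset[OF a(2), of i] a(1) by auto
  show "(i + gap N A i) mod N \<in> A"
    unfolding gap_def by (rule LeastI[where P = "\<lambda>d. (i + d) mod N \<in> A", OF d(2)])
  show "gap N A i < N"
    unfolding gap_def using Least_le[where P = "\<lambda>d. (i + d) mod N \<in> A", OF d(2)] d(1) by linarith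
qed

text \<open>
  The local computation behind the theorem. The class 1 particle of the row above is in column \<open>c\<close> and
  picks the particle in column \<open>e\<close> of the row \<open>A\<close>; the ringing path hits the row in column \<open>p\<close> and
  continues in column \<open>ring_exit N A p\<close>, where it pushes the upper particle to the left exactly if it
  meets it. The lower class 1 particle is pushed in the same sense if \<open>p = e\<close>. When both or none are pushed, the gap between them keeps
  its length; otherwise it shrinks or grows by one.
\<close>

lemma ring_row_next_particle:
  assumes A: "A \<subseteq> {..<N}" "A \<noteq> {}" and c: "c < N" and p: "p < N"
  defines "e \<equiv> (c + gap N A c) mod N"
    and "c' \<equiv> (if ring_exit N A p = c then left_of N c else c)"
  shows "gap N (ring_row N A p) c' + of_bool (p = e) = gap N A c + of_bool (ring_exit N A p = c)"
    and "(c' + gap N (ring_row N A p) c') mod N = (if p = e then left_of N e else e)"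
proof -
  define d where "d = gap N A c"
  have dA: "(c + d) mod N \<in> A" and dN: "d < N"
    using gap_in[OF A c] gap_less[OF A c] by (simp_all add: d_def)
  have before: "(c + k) mod N \<notin> A" if "k < d" for k
    using that unfolding d_def by (rule not_in_before_gap)
  have e: "e = (c + d) mod N"
    by (simp add: e_def d_def)
  have c0: "(c + 0) mod N = c"
    using c by simp
  \<comment> \<open>In the case \<open>meet\<close> the two particles are in the same column and are pushed together; in the
    case \<open>approach\<close> only the lower one is pushed, towards the upper one. If the path hits a vacancy,
    the upper one may be pushed away, and if it hits another particle, this one cannot enter the gap.\<close>
  consider (meet) "p = e" "d = 0" | (approach) "p = e" "0 < d" | (vacant) "p \<noteq> e" "p \<notin> A"
    | (other) "p \<noteq> e" "p \<in> A"
    by blast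
  then have "gap N (ring_row N A p) c' + of_bool (p = e) = d + of_bool (ring_exit N A p = c) \<and>
      (c' + gap N (ring_row N A p) c') mod N = (if p = e then left_of N e else e)"
  proof cases
    case meet
    then have "p = c" "p \<in> A"
      using dA c0 e by auto
    then have c': "ring_exit N A p = c" "c' = left_of N c"
      by (simp_all add: ring_exit_def c'_def)
    have "gap N (ring_row N A p) c' = 0"
      using c \<open>p = c\<close> \<open>p \<in> A\<close> left_of_less[of N c] by (intro gap_eqI) (auto simp: c' ring_row_def)
    then show ?thesis
      using meet c' \<open>p = c\<close> c left_of_less[of N c] by simp
  next
    case approach
    have pA: "p \<in> A"
      using dA e approach by simp
    have "c \<notin> A"
      using before[of 0] approach c by simp
    then have c': "ring_exit N A p \<noteq> c" "c' = c"
      using pA by (auto simp: ring_exit_def c'_def)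
    have left: "left_of N e = (c + (d - 1)) mod N"
    proof -
      have "e = Suc ((c + (d - 1)) mod N) mod N"
        using approach by (simp add: e mod_Suc_eq)
      then show ?thesis
        using c left_of_Suc_mod[of "(c + (d - 1)) mod N" N] by simp
    qed
    then have leftA: "left_of N e \<notin> A"
      using before[of "d - 1"] approach by simp
    have "gap N (ring_row N A p) c' = d - 1"
    proof (rule gap_eqI)
      show "(c' + (d - 1)) mod N \<in> ring_row N A p"
        using leftA pA approach by (simp add: ring_row_def c' left)
      fix k assume k: "k < d - 1"
      have "k = d - 1" if "(c + k) mod N = left_of N e"
        by (rule add_mod_inject[of c _ N]) (use that left k dN in auto)
      then have "(c + k) mod N \<noteq> left_of N e"
        using k by auto
      then show "(c' + k) mod N \<notin> ring_row N A p"
        using k before[of k] approach by (simp add: ring_row_def c')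
    qed
    then show ?thesis
      using approach c' left by simp
  next
    case vacant
    then have row: "ring_row N A p = A" and ex: "ring_exit N A p = Suc p mod N"
      by (simp_all add: ring_row_def ring_exit_def)
    show ?thesis
    proof (cases "Suc p mod N = c")
      case True
      then have c': "c' = p"
        using ex left_of_Suc_mod[OF p] by (simp add: c'_def)
      have shift: "(p + Suc k) mod N = (c + k) mod N" for k
        using True by (metis add_Suc_shift mod_add_left_eq)
      have "gap N A p = Suc d"
      proof (rule gap_eqI)
        show "(p + Suc d) mod N \<in> A"
          using dA shift by simp
        show "(p + k) mod N \<notin> A" if "k < Suc d" for k
          using that vacant p before shift by (cases k) auto
      qed
      then show ?thesis
        using vacant row ex True c' shift[of d] e by simp
    next
      case False
      then show ?thesis
        using vacant row ex e d_def by (simp add: c'_def)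
    qed
  next
    case other
    have "p \<noteq> c"
    proof
      assume "p = c"
      then have "d = 0"
        using before[of 0] other c by fastforce
      then show False
        using other e c \<open>p = c\<close> by simp
    qed
    then have c': "ring_exit N A p \<noteq> c" "c' = c"
      using other by (auto simp: ring_exit_def c'_def)
    have "gap N (ring_row N A p) c' = d"
    proof (rule gap_eqI)
      show "(c' + d) mod N \<in> ring_row N A p"
        using dA e other c' by (simp add: ring_row_def)
      fix k assume k: "k < d"
      have "(c + k) mod N \<noteq> left_of N p"
      proof
        assume "(c + k) mod N = left_of N p"
        then have "p = (c + Suc k) mod N"
          using Suc_left_of_mod[OF p] by (metis add_Suc_right mod_Suc_eq)
        then show False
          using other e before[of "Suc k"] k by (cases "Suc k = d") auto
      qed
      then show "(c' + k) mod N \<notin> ring_row N A p"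
        using before[OF k] c' by (simp add: ring_row_def)
    qed
    then show ?thesis
      using other c' e by simp
  qed
  then show "gap N (ring_row N A p) c' + of_bool (p = e) = gap N A c + of_bool (ring_exit N A p = c)"
    and "(c' + gap N (ring_row N A p) c') mod N = (if p = e then left_of N e else e)"
    by (simp_all add: d_def)
qed

section \<open>The class 1 particles\<close>

text \<open>
  The column of the class 1 particle, computed without the classes: processed first, it always takes
  the next particle in the row below. The value in row 0 starts a search in row 1, which
  finds the only particle there from any column.
\<close>

primrec lead :: "nat \<Rightarrow> mlq \<Rightarrow> nat \<Rightarrow> nat" where
  "lead N Q 0 = 0"
| "lead N Q (Suc r) = (lead N Q r + gap N (row Q (Suc r)) (lead N Q r)) mod N"

text \<open>
  The bound on the length ensures that the columns \<open>A\<close> are not exhausted, so that every search finds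
  a particle instead of an arbitrary value of \<open>LEAST\<close>.
\<close>

lemma bully_match_mem:
  assumes "length js \<le> card A" "A \<subseteq> {..<N}" "set js \<subseteq> {..<N}" "(i, d) \<in> set (bully_match N js A)"
  shows "i \<in> set js \<and> (i + d) mod N \<in> A"
  using assms
proof (induction js arbitrary: A)
  case Nil
  then show ?case by simp
next
  case (Cons j js)
  let ?a = "(j + gap N A j) mod N"
  have fin: "finite A"
    using Cons.prems(2) finite_subset by blast
  have "A \<noteq> {}"
    using Cons.prems(1) by auto
  then have a: "?a \<in> A"
    using Cons.prems by (intro gap_in) auto
  then have card: "length js \<le> card (A - {?a})"
    using Cons.prems(1) by simp
  have "(i, d) = (j, gap N A j) \<or> (i, d) \<in> set (bully_match N js (A - {?a}))"
    using Cons.prems(4) by (auto simp: gap_def Let_def)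
  then show ?case
    using a Cons.IH[OF card] Cons.prems(2,3) by auto
qed

locale single_first_class =
  fixes n :: nat and m :: "nat \<Rightarrow> nat"
  assumes n2: "2 \<le> n"
    and m_pos: "\<And>j. j \<in> {1..n} \<Longrightarrow> 0 < m j"
    and m1: "m 1 = 1"
begin

abbreviation "N \<equiv> partial_size m n"

lemma partial_size_Suc: "partial_size m (Suc r) = partial_size m r + m (Suc r)"
  by (simp add: partial_size_def)

lemma partial_size_1: "partial_size m (Suc 0) = 1"
  using m1 by (simp add: partial_size_def)

lemma partial_size_strict_mono:
  assumes "r < r'" "r' \<le> n"
  shows "partial_size m r < partial_size m r'"
  using assms
proof (induction r')
  case (Suc k)
  then show ?case
    using m_pos[of "Suc k"] by (cases "r = k") (auto simp: partial_size_Suc)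
qed simp

lemma N_ge_2: "2 \<le> N"
  using partial_size_strict_mono[of "Suc 0" n] n2 partial_size_1 by simp

lemma N_pos: "0 < N"
  using N_ge_2 by simp

lemma partial_size_pos: "r \<in> {1..n} \<Longrightarrow> 0 < partial_size m r"
  using partial_size_strict_mono[of 0 r] by (simp add: partial_size_def)

lemma row_0: "Q \<in> mlqs n m \<Longrightarrow> row Q 0 = {}"
  by (auto simp: mlqs_def row_def)

lemma row_subset: "Q \<in> mlqs n m \<Longrightarrow> row Q r \<subseteq> {..<N}"
  by (auto simp: mlqs_def row_def)

lemma finite_row: "Q \<in> mlqs n m \<Longrightarrow> finite (row Q r)"
  using row_subset finite_subset by blast

lemma card_row: "Q \<in> mlqs n m \<Longrightarrow> r < n \<Longrightarrow> card (row Q r) = partial_size m r"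
  by (cases "r = 0") (auto simp: row_0 mlqs_def partial_size_def)

lemma row_nonempty: "Q \<in> mlqs n m \<Longrightarrow> r \<in> {1..n - 1} \<Longrightarrow> row Q r \<noteq> {}"
  using card_row[of Q r] partial_size_pos[of r] n2 by (cases "r < n") force+

lemma finite_mlqs: "finite (mlqs n m)"
  by (rule finite_subset[of _ "Pow ({1..n - 1} \<times> {..<N})"]) (auto simp: mlqs_def)

lemma mlq_eqI:
  assumes "Q \<in> mlqs n m" "Q' \<in> mlqs n m" "\<And>r. r \<in> {1..n - 1} \<Longrightarrow> row Q r = row Q' r"
  shows "Q = Q'"
proof -
  have "(r, i) \<in> Q \<longleftrightarrow> (r, i) \<in> Q'" for r i
    using assms(1,2) assms(3)[of r] by (cases "r \<in> {1..n - 1}") (auto simp: mlqs_def row_def)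
  then show ?thesis by auto
qed

lemma lead_less: "lead N Q r < N"
  using N_pos by (cases r) auto

lemma lead_in_row: "Q \<in> mlqs n m \<Longrightarrow> r \<in> {1..n - 1} \<Longrightarrow> lead N Q r \<in> row Q r"
  by (cases r) (simp, metis gap_in lead.simps(2) row_subset row_nonempty lead_less)

lemma row_1:
  assumes "Q \<in> mlqs n m"
  shows "row Q (Suc 0) = {lead N Q (Suc 0)}"
proof -
  have "card (row Q (Suc 0)) = 1"
    using card_row[OF assms, of "Suc 0"] partial_size_1 n2 by simp
  then obtain a where "row Q (Suc 0) = {a}"
    by (rule card_1_singletonE)
  moreover have "lead N Q (Suc 0) \<in> row Q (Suc 0)"
    using n2 by (intro lead_in_row[OF assms]) simp
  ultimately show ?thesis
    by (simp only: singleton_iff)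
qed

lemma bully_moves_mem:
  assumes Q: "Q \<in> mlqs n m" and r: "Suc r < n" and dom: "dom (classes N Q r) = row Q r"
    and mem: "(i, d) \<in> set (bully_moves N (classes N Q r) (row Q (Suc r)))"
  shows "i \<in> row Q r" "(i + d) mod N \<in> row Q (Suc r)"
proof -
  have "card (row Q r) \<le> card (row Q (Suc r))"
    using card_row[OF Q] partial_size_Suc[of r] r by simp
  moreover define js where "js = sort_key (\<lambda>i. the (classes N Q r i)) (sorted_list_of_set (row Q r))"
  moreover have "set js = row Q r" "length js = card (row Q r)"
    using finite_row[OF Q] by (simp_all add: js_def)
  ultimately have "i \<in> row Q r \<and> (i + d) mod N \<in> row Q (Suc r)"
    using bully_match_mem[of js "row Q (Suc r)" N i d] mem dom row_subset[OF Q]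
    by (simp add: bully_moves_def)
  then show "i \<in> row Q r" "(i + d) mod N \<in> row Q (Suc r)" by auto
qed

lemma dom_classes:
  assumes Q: "Q \<in> mlqs n m" and "r < n"
  shows "dom (classes N Q r) = row Q r"
  using assms(2)
proof (induction r)
  case 0
  then show ?case by (simp add: row_0[OF Q])
next
  case (Suc r)
  then have dom: "dom (classes N Q r) = row Q r" by simp
  have "(\<lambda>(i, d). (i + d) mod N) ` set (bully_moves N (classes N Q r) (row Q (Suc r)))
      \<subseteq> row Q (Suc r)"
    using bully_moves_mem(2)[OF Q Suc.prems dom] by auto
  then have "dom (map_of (map (\<lambda>(i, d). ((i + d) mod N, the (classes N Q r i)))
      (bully_moves N (classes N Q r) (row Q (Suc r))))) \<subseteq> row Q (Suc r)"
    by (simp add: dom_map_of_conv_image_fst image_image case_prod_unfold)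
  moreover have "dom (\<lambda>j. if j \<in> row Q (Suc r) then Some (Suc r) else None) = row Q (Suc r)"
    by (auto split: if_splits)
  ultimately show ?case
    by (simp only: classes.simps dom_map_add) blast
qed

lemma classes_range:
  assumes Q: "Q \<in> mlqs n m" and "r < n" and "classes N Q r i = Some k"
  shows "1 \<le> k \<and> k \<le> r"
  using assms(2,3)
proof (induction r arbitrary: i k)
  case 0
  then show ?case by simp
next
  case (Suc r)
  let ?moves = "bully_moves N (classes N Q r) (row Q (Suc r))"
  have dom: "dom (classes N Q r) = row Q r"
    using Suc.prems by (intro dom_classes[OF Q]) simp
  from Suc.prems(2) consider "k = Suc r"
    | "map_of (map (\<lambda>(i, d). ((i + d) mod N, the (classes N Q r i))) ?moves) i = Some k"
    by (auto simp: map_add_Some_iff split: if_splits)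
  then show ?case
  proof cases
    case 2
    then obtain j d where j: "(j, d) \<in> set ?moves" "k = the (classes N Q r j)"
      by (auto dest!: map_of_SomeD)
    then have "j \<in> dom (classes N Q r)"
      using bully_moves_mem(1)[OF Q Suc.prems(1) dom] dom by simp
    then have "classes N Q r j = Some k"
      using j(2) by auto
    then show ?thesis
      using Suc.IH[of j k] Suc.prems(1) by simp
  qed simp
qed

text \<open>
  The class 1 particle is the only one of the lowest class, so it heads the sorted list.
  The other particles choose from what it leaves over.
\<close>

lemma bully_moves_lead_first:
  assumes Q: "Q \<in> mlqs n m" and r: "1 \<le> r" "Suc r < n"
    and one: "\<And>i. classes N Q r i = Some 1 \<longleftrightarrow> i = lead N Q r"
  obtains js where
    "bully_moves N (classes N Q r) (row Q (Suc r)) =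
       (lead N Q r, gap N (row Q (Suc r)) (lead N Q r)) #
       bully_match N js (row Q (Suc r) - {lead N Q (Suc r)})"
    "set js = row Q r - {lead N Q r}"
    "length js \<le> card (row Q (Suc r) - {lead N Q (Suc r)})"
proof -
  let ?f = "\<lambda>i. the (classes N Q r i)"
  define L where "L = sort_key ?f (sorted_list_of_set (row Q r))"
  have dom: "dom (classes N Q r) = row Q r"
    using r by (intro dom_classes[OF Q]) simp
  have L: "set L = row Q r" "distinct L" "length L = card (row Q r)" "sorted (map ?f L)"
    using finite_row[OF Q] by (simp_all add: L_def)
  have lead: "lead N Q r \<in> set L"
    using lead_in_row[OF Q] r L by simp
  then obtain l js where Ljs: "L = l # js"
    by (cases L) auto
  have "?f l \<le> ?f (lead N Q r)"
    using L(4) lead unfolding Ljs by auto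
  moreover have "?f (lead N Q r) = 1"
    using one[of "lead N Q r"] by simp
  moreover obtain k where k: "classes N Q r l = Some k"
    using L(1) dom Ljs by auto
  moreover have "1 \<le> k"
    using classes_range[OF Q _ k] r by simp
  ultimately have "classes N Q r l = Some 1"
    by simp
  then have l: "l = lead N Q r"
    by (simp only: one)
  show thesis
  proof (rule that)
    show "bully_moves N (classes N Q r) (row Q (Suc r)) =
       (lead N Q r, gap N (row Q (Suc r)) (lead N Q r)) #
       bully_match N js (row Q (Suc r) - {lead N Q (Suc r)})"
      by (simp add: bully_moves_def dom L_def[symmetric] Ljs l gap_def Let_def)
    show "set js = row Q r - {lead N Q r}"
      using L(1,2) Ljs l by auto
    have "Suc (length js) \<le> card (row Q (Suc r))"
      using L(3) card_row[OF Q] partial_size_Suc[of r] r Ljs by simp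
    moreover have "lead N Q (Suc r) \<in> row Q (Suc r)"
      using r by (intro lead_in_row[OF Q]) simp
    ultimately show "length js \<le> card (row Q (Suc r) - {lead N Q (Suc r)})"
      using finite_row[OF Q] by (simp del: lead.simps)
  qed
qed

lemma classes_eq_1_iff:
  assumes Q: "Q \<in> mlqs n m" and "1 \<le> r" "r < n"
  shows "classes N Q r i = Some 1 \<longleftrightarrow> i = lead N Q r"
  using assms(2,3)
proof (induction r arbitrary: i rule: nat_induct_at_least)
  case base
  show ?case
    using row_1[OF Q] by (simp add: bully_moves_def del: lead.simps)
next
  case (Suc r)
  have one: "classes N Q r i = Some 1 \<longleftrightarrow> i = lead N Q r" for i
    using Suc.IH Suc.prems by simp
  obtain js where moves: "bully_moves N (classes N Q r) (row Q (Suc r)) =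
       (lead N Q r, gap N (row Q (Suc r)) (lead N Q r)) #
       bully_match N js (row Q (Suc r) - {lead N Q (Suc r)})"
    and js: "set js = row Q r - {lead N Q r}"
    and len: "length js \<le> card (row Q (Suc r) - {lead N Q (Suc r)})"
    using bully_moves_lead_first[OF Q Suc.hyps Suc.prems one] by blast
  let ?key = "\<lambda>(i, d). ((i + d) mod N, the (classes N Q r i))"
  have cl: "classes N Q (Suc r) = (\<lambda>j. if j \<in> row Q (Suc r) then Some (Suc r) else None) ++
     (map_of (map ?key (bully_match N js (row Q (Suc r) - {lead N Q (Suc r)}))))
       (lead N Q (Suc r) \<mapsto> 1)"
    using one[of "lead N Q r"] by (simp add: moves)
  show ?case
  proof (cases "i = lead N Q (Suc r)")
    case True
    then show ?thesis
      unfolding cl by (simp del: lead.simps)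
  next
    case False
    have "classes N Q (Suc r) i \<noteq> Some 1"
    proof
      assume "classes N Q (Suc r) i = Some 1"
      then have "map_of (map ?key (bully_match N js (row Q (Suc r) - {lead N Q (Suc r)}))) i = Some 1"
        using False Suc.hyps unfolding cl
        by (auto simp: map_add_Some_iff simp del: lead.simps split: if_splits)
      then obtain j d where j: "(j, d) \<in> set (bully_match N js (row Q (Suc r) - {lead N Q (Suc r)}))"
        "the (classes N Q r j) = 1"
        by (auto dest!: map_of_SomeD simp del: lead.simps)
      then have "j \<in> set js"
        using bully_match_mem[OF len _ _ j(1)] row_subset[OF Q] js by blast
      then have "j \<in> dom (classes N Q r)" "j \<noteq> lead N Q r"
        using js dom_classes[OF Q, of r] Suc.prems by auto
      then show False
        using one[of j] j(2) by auto
    qed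
    then show ?thesis
      using False by simp
  qed
qed

lemma bully_projection_eq_1_iff:
  assumes "Q \<in> mlqs n m"
  shows "bully_projection n m Q i = 1 \<longleftrightarrow> i = lead N Q (n - 1)"
  using classes_eq_1_iff[OF assms, of "n - 1" i] n2
  by (cases "classes N Q (n - 1) i") (auto simp: bully_projection_def)

lemma bully_projection_range:
  assumes "Q \<in> mlqs n m"
  shows "bully_projection n m Q i \<in> {1..n}"
  using classes_range[OF assms, of "n - 1" i] n2
  by (cases "classes N Q (n - 1) i") (fastforce simp: bully_projection_def)+

text \<open>
  The bully path of the class 1 particle ends at the first particle it meets, so its last column is the
  only one on the path that is not vacant.
\<close>

lemma covered_vacancies_eq:
  assumes Q: "Q \<in> mlqs n m" and r: "1 \<le> r" "Suc r < n"
  shows "covered_vacancies N Q (Suc r) =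
    (\<lambda>e. (lead N Q r + e) mod N) ` {..<gap N (row Q (Suc r)) (lead N Q r)}"
proof -
  let ?d = "gap N (row Q (Suc r)) (lead N Q r)"
  have one: "classes N Q r i = Some 1 \<longleftrightarrow> i = lead N Q r" for i
    using classes_eq_1_iff[OF Q] r by simp
  obtain js where moves: "bully_moves N (classes N Q r) (row Q (Suc r)) =
       (lead N Q r, ?d) # bully_match N js (row Q (Suc r) - {lead N Q (Suc r)})"
    and js: "set js = row Q r - {lead N Q r}"
    and len: "length js \<le> card (row Q (Suc r) - {lead N Q (Suc r)})"
    using bully_moves_lead_first[OF Q r one] by blast
  have rest: "(lead N Q r, d) \<notin> set (bully_match N js (row Q (Suc r) - {lead N Q (Suc r)}))" for d
    using bully_match_mem[OF len, of N "lead N Q r" d] row_subset[OF Q] js by blast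
  have "covered_vacancies N Q (Suc r) =
      {j. j \<notin> row Q (Suc r) \<and> (\<exists>e\<le>?d. j = (lead N Q r + e) mod N)}"
    using rest one unfolding covered_vacancies_def
    by (simp add: moves del: lead.simps)
  also have "\<dots> = (\<lambda>e. (lead N Q r + e) mod N) ` {..<?d}"
  proof -
    have "(lead N Q r + ?d) mod N \<in> row Q (Suc r)"
      using r by (intro gap_in row_subset row_nonempty Q lead_less) simp
    then show ?thesis
      using not_in_before_gap[of _ N "row Q (Suc r)" "lead N Q r"]
      by (auto simp: le_less)
  qed
  finally show ?thesis .
qed

lemma card_covered_vacancies:
  assumes Q: "Q \<in> mlqs n m" and r: "1 \<le> r" "Suc r < n"
  shows "card (covered_vacancies N Q (Suc r)) = gap N (row Q (Suc r)) (lead N Q r)"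
proof -
  have "gap N (row Q (Suc r)) (lead N Q r) < N"
    using r by (intro gap_less row_subset row_nonempty Q lead_less) simp
  then have "inj_on (\<lambda>e. (lead N Q r + e) mod N) {..<gap N (row Q (Suc r)) (lead N Q r)}"
    by (auto intro!: inj_onI dest: add_mod_inject)
  then show ?thesis
    by (simp add: covered_vacancies_eq[OF assms] card_image)
qed

lemma z_one_eq_sum_gap:
  assumes "Q \<in> mlqs n m"
  shows "z_one n m Q = (\<Sum>r = 2..n - 1. gap N (row Q r) (lead N Q (r - 1)))"
  unfolding z_one_def
proof (rule sum.cong)
  fix r assume "r \<in> {2..n - 1}"
  then have "1 \<le> r - 1" "Suc (r - 1) < n" "Suc (r - 1) = r"
    using n2 by auto
  then show "card (covered_vacancies N Q r) = gap N (row Q r) (lead N Q (r - 1))"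
    using card_covered_vacancies[OF assms, of "r - 1"] by simp
qed simp

lemma z_one_le_v_one:
  assumes Q: "Q \<in> mlqs n m"
  shows "z_one n m Q \<le> v_one n m"
  unfolding z_one_def v_one_def
proof (rule sum_mono)
  fix r assume r: "r \<in> {2..n - 1}"
  have "covered_vacancies N Q r \<subseteq> {..<N} - row Q r"
    using N_pos by (auto simp: covered_vacancies_def)
  then have "card (covered_vacancies N Q r) \<le> card ({..<N} - row Q r)"
    by (rule card_mono[rotated]) simp
  also have "\<dots> = N - partial_size m r"
    using card_row[OF Q, of r] r n2 row_subset[OF Q] finite_row[OF Q] by (subst card_Diff_subset) auto
  finally show "card (covered_vacancies N Q r) \<le> N - partial_size m r" .
qed

section \<open>Ringing path transitions\<close>

lemma row_ring_transition:
  assumes "r \<in> {1..n - 1}"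
  shows "row (ring_transition n N Q i) r = ring_row N (row Q r) (ring_pos n N Q i r)"
  using assms by (auto simp: ring_transition_def ring_rows_def row_def ring_row_def)

lemma ring_pos_eq_exit:
  assumes "r < n - 1"
  shows "ring_pos n N Q i r = ring_exit N (row Q (Suc r)) (ring_pos n N Q i (Suc r))"
  using assms by (subst ring_pos.simps) (simp add: ring_exit_def row_def Let_def)

lemma ring_pos_bottom: "ring_pos n N Q i (n - 1) = i"
  by (simp add: ring_pos.simps)

lemma ring_pos_less:
  assumes "i < N" "r \<le> n - 1"
  shows "ring_pos n N Q i r < N"
  using assms(2)
proof (induction r rule: inc_induct)
  case base
  then show ?case using assms ring_pos_bottom by simp
next
  case (step r)
  then show ?case by (simp add: ring_pos_eq_exit ring_exit_less)
qed

lemma ring_transition_in_mlqs: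
  assumes Q: "Q \<in> mlqs n m"
  shows "ring_transition n N Q i \<in> mlqs n m"
  unfolding mlqs_def
proof (intro CollectI conjI ballI)
  show "ring_transition n N Q i \<subseteq> {1..n - 1} \<times> {..<N}"
    using Q left_of_less[OF N_pos] by (auto simp: ring_transition_def ring_rows_def mlqs_def)
  fix r assume r: "r \<in> {1..n - 1}"
  then have "r < n"
    by auto
  then show "card (row (ring_transition n N Q i) r) = partial_size m r"
    using r finite_row[OF Q] card_row[OF Q, of r]
    by (simp add: row_ring_transition card_ring_row)
qed

text \<open>
  Going down from row 0, the position of the path in each row and the new configuration of the
  row below determine the old configuration of that row and the position of the path in it.
\<close>

lemma ring_transition_inj:
  assumes Q: "Q \<in> mlqs n m" "Q' \<in> mlqs n m" and i: "i < N" "i' < N"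
    and same: "ring_transition n N Q i = ring_transition n N Q' i'"
      "ring_pos n N Q i 0 = ring_pos n N Q' i' 0"
  shows "Q = Q'" "i = i'"
proof -
  have step: "row Q (Suc r) = row Q' (Suc r) \<and> ring_pos n N Q i (Suc r) = ring_pos n N Q' i' (Suc r)"
    if "ring_pos n N Q i r = ring_pos n N Q' i' r" "r < n - 1" for r
  proof -
    have "unring_row N (row (ring_transition n N Q i) (Suc r)) (ring_pos n N Q i r) =
        (row Q (Suc r), ring_pos n N Q i (Suc r))"
      "unring_row N (row (ring_transition n N Q' i') (Suc r)) (ring_pos n N Q' i' r) =
        (row Q' (Suc r), ring_pos n N Q' i' (Suc r))"
      using that(2) i
      by (simp_all add: row_ring_transition ring_pos_eq_exit unring_row_ring_row ring_pos_less)
    then show ?thesis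
      using same that(1) by simp
  qed
  have pos: "ring_pos n N Q i r = ring_pos n N Q' i' r" if "r \<le> n - 1" for r
    using that by (induction r) (use same(2) step in auto)
  have "row Q r = row Q' r" if "r \<in> {1..n - 1}" for r
  proof -
    have "r - 1 < n - 1" "Suc (r - 1) = r"
      using that by auto
    then show ?thesis
      using step[OF pos, of "r - 1"] by simp
  qed
  then show "Q = Q'"
    by (rule mlq_eqI[OF Q])
  show "i = i'"
    using pos[of "n - 1"] by (simp only: ring_pos_bottom order_refl)
qed

lemma bij_betw_ring:
  "bij_betw (\<lambda>(Q, i). (ring_transition n N Q i, ring_pos n N Q i 0))
     (mlqs n m \<times> {..<N}) (mlqs n m \<times> {..<N})"
proof -
  let ?F = "\<lambda>(Q, i). (ring_transition n N Q i, ring_pos n N Q i 0)"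
  have inj: "inj_on ?F (mlqs n m \<times> {..<N})"
    by (rule inj_onI) (auto dest: ring_transition_inj)
  have "?F ` (mlqs n m \<times> {..<N}) \<subseteq> mlqs n m \<times> {..<N}"
    by (auto simp: ring_transition_in_mlqs ring_pos_less)
  then have "?F ` (mlqs n m \<times> {..<N}) = mlqs n m \<times> {..<N}"
    using inj finite_mlqs by (intro endo_inj_surj) auto
  then show ?thesis
    using inj by (simp add: bij_betw_def)
qed

text \<open>
  Row by row from the top: in row 1 the particle is alone, so it can always jump to the left when it is
  rung, because there are at least two columns. Below row 1 it may be blocked by a neighbour. Then the
  class 1 particle above is in the same column and is pushed by the path as well, and the class 1 label
  passes to the neighbour.
\<close>

lemma lead_ring_transition:
  assumes Q: "Q \<in> mlqs n m" and i: "i < N" and "1 \<le> r" "r \<le> n - 1"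
  shows "lead N (ring_transition n N Q i) r =
    (if ring_pos n N Q i r = lead N Q r then left_of N (lead N Q r) else lead N Q r)"
  using assms(3,4)
proof (induction r rule: nat_induct_at_least)
  case base
  let ?p = "ring_pos n N Q i (Suc 0)" and ?a = "lead N Q (Suc 0)"
  have "left_of N ?a \<noteq> ?a"
  proof
    assume "left_of N ?a = ?a"
    then have "Suc ?a mod N = ?a"
      using Suc_left_of_mod[OF lead_less, of Q "Suc 0"] by simp
    then show False
      using lead_less[of Q "Suc 0"] N_ge_2 by (cases "Suc ?a = N") (auto simp del: lead.simps)
  qed
  then have "row (ring_transition n N Q i) (Suc 0) = {if ?p = ?a then left_of N ?a else ?a}"
    using base row_1[OF Q] by (simp add: row_ring_transition ring_row_def del: lead.simps)
  then show ?case
    using row_1[OF ring_transition_in_mlqs[OF Q], of i] by (simp del: lead.simps)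
next
  case (Suc r)
  have "row Q (Suc r) \<noteq> {}"
    using Suc.prems by (intro row_nonempty Q) simp
  from ring_row_next_particle(2)[OF row_subset[OF Q] this lead_less ring_pos_less[OF i Suc.prems], of Q Q]
  show ?case
    using Suc.prems Suc.IH by (simp add: row_ring_transition ring_pos_eq_exit)
qed

lemma gap_ring_transition:
  assumes Q: "Q \<in> mlqs n m" and i: "i < N" and r: "1 \<le> r" "Suc r \<le> n - 1"
  shows "gap N (row (ring_transition n N Q i) (Suc r)) (lead N (ring_transition n N Q i) r)
      + of_bool (ring_pos n N Q i (Suc r) = lead N Q (Suc r))
    = gap N (row Q (Suc r)) (lead N Q r) + of_bool (ring_pos n N Q i r = lead N Q r)"
proof -
  have "row Q (Suc r) \<noteq> {}"
    using r by (intro row_nonempty Q) simp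
  from ring_row_next_particle(1)[OF row_subset[OF Q] this lead_less ring_pos_less[OF i r(2)], of Q Q]
  show ?thesis
    using r lead_ring_transition[OF Q i r(1)] by (simp add: row_ring_transition ring_pos_eq_exit)
qed

lemma z_one_ring_transition:
  assumes Q: "Q \<in> mlqs n m" and i: "i < N"
  shows "z_one n m (ring_transition n N Q i) + of_bool (i = lead N Q (n - 1)) =
    z_one n m Q + of_bool (ring_pos n N Q i 1 = lead N Q 1)"
proof -
  let ?Q' = "ring_transition n N Q i"
  have "(\<Sum>r = 2..R. gap N (row ?Q' r) (lead N ?Q' (r - 1))) + of_bool (ring_pos n N Q i R = lead N Q R)
    = (\<Sum>r = 2..R. gap N (row Q r) (lead N Q (r - 1))) + of_bool (ring_pos n N Q i 1 = lead N Q 1)"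
    if "1 \<le> R" "R \<le> n - 1" for R
    using that
  proof (induction R rule: nat_induct_at_least)
    case base
    then show ?case by simp
  next
    case (Suc R)
    then show ?case
      using gap_ring_transition[OF Q i Suc.hyps Suc.prems] by (simp del: lead.simps)
  qed
  from this[of "n - 1"] show ?thesis
    using n2 unfolding z_one_eq_sum_gap[OF Q] z_one_eq_sum_gap[OF ring_transition_in_mlqs[OF Q]]
      ring_pos_bottom by linarith
qed

text \<open>
  The position of the path above row 1 and the new state tell whether the class 1 particle of row 1 jumped:
  if it did, the path left through the column it came from, which is right of its new place. A path through
  a vacancy leaves right of that vacancy instead.
\<close>

lemma ring_pos_0_eq_iff:
  assumes Q: "Q \<in> mlqs n m" and i: "i < N"
  shows "ring_pos n N Q i 0 = Suc (lead N (ring_transition n N Q i) 1) mod N \<longleftrightarrow>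
    ring_pos n N Q i 1 = lead N Q 1"
proof -
  have p: "ring_pos n N Q i 1 < N"
    using n2 by (intro ring_pos_less i) simp
  have exit: "ring_pos n N Q i 0 =
      (if ring_pos n N Q i 1 = lead N Q 1 then ring_pos n N Q i 1 else Suc (ring_pos n N Q i 1) mod N)"
    using n2 row_1[OF Q] by (simp add: ring_pos_eq_exit ring_exit_def del: lead.simps)
  have lead: "lead N (ring_transition n N Q i) 1 =
      (if ring_pos n N Q i 1 = lead N Q 1 then left_of N (lead N Q 1) else lead N Q 1)"
    using n2 by (intro lead_ring_transition Q i) simp_all
  show ?thesis
    unfolding exit lead using Suc_left_of_mod[OF lead_less] p left_of_Suc_mod[OF p]
      left_of_Suc_mod[OF lead_less[of Q 1]] by (auto simp del: lead.simps)
qed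

lemma mlq_weight_transport:
  assumes Q: "Q \<in> mlqs n m" and i: "i < N"
  shows "mlq_weight n m y Q * (if i = lead N Q (n - 1) then y else 1) =
    mlq_weight n m y (ring_transition n N Q i) *
      (if ring_pos n N Q i 0 = Suc (lead N (ring_transition n N Q i) 1) mod N then y else 1)"
proof -
  have *: "mlq_weight n m y Q * (if b then y else 1) = y ^ (v_one n m - z_one n m Q + of_bool b)" for Q b
    by (simp add: mlq_weight_def)
  have "v_one n m - z_one n m Q + of_bool (i = lead N Q (n - 1)) =
      v_one n m - z_one n m (ring_transition n N Q i) + of_bool (ring_pos n N Q i 1 = lead N Q 1)"
    using z_one_ring_transition[OF Q i] z_one_le_v_one[OF Q]
      z_one_le_v_one[OF ring_transition_in_mlqs[OF Q], of i] by linarith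
  then show ?thesis
    unfolding * ring_pos_0_eq_iff[OF Q i] by simp
qed

lemma sum_ring_rate:
  assumes "Q \<in> mlqs n m"
  shows "(\<Sum>Q'\<in>mlqs n m. ring_rate n m x Q Q') = (\<Sum>i<N. x (bully_projection n m Q i))"
  unfolding ring_rate_def
  by (rule sum.group[OF _ finite_mlqs]) (auto simp: ring_transition_in_mlqs assms)

text \<open>
  The sum over all states and ringing columns is carried over to the images of the bijection, where
  the summand is supported on \<open>T\<close>, and in it just one exit column has the factor \<open>x 1\<close>.
  Likewise just one column of \<open>T\<close> rings at rate \<open>x 1\<close>.
\<close>

lemma mlq_weight_balance:
  assumes x: "\<And>j. j \<in> {2..n} \<Longrightarrow> x j = 1" and T: "T \<in> mlqs n m"
  shows "(\<Sum>Q\<in>mlqs n m. mlq_weight n m (x 1) Q * ring_rate n m x Q T) =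
    mlq_weight n m (x 1) T * (\<Sum>Q'\<in>mlqs n m. ring_rate n m x T Q')"
proof -
  let ?w = "mlq_weight n m (x 1)"
  let ?g = "\<lambda>(Q, q). if Q = T then ?w Q * (if q = Suc (lead N Q 1) mod N then x 1 else 1) else 0"
  let ?F = "\<lambda>(Q, i). (ring_transition n N Q i, ring_pos n N Q i 0)"
  have rate: "x (bully_projection n m Q i) = (if i = lead N Q (n - 1) then x 1 else 1)"
    if "Q \<in> mlqs n m" for Q i
  proof -
    have "bully_projection n m Q i \<in> {2..n}" if "i \<noteq> lead N Q (n - 1)"
      using bully_projection_range[OF \<open>Q \<in> mlqs n m\<close>, of i] that
        bully_projection_eq_1_iff[OF \<open>Q \<in> mlqs n m\<close>, of i] by auto
    then show ?thesis
      using bully_projection_eq_1_iff[OF that, of i] x by auto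
  qed
  have marked: "(\<Sum>q<N. if q = a then x 1 else 1) = x 1 + (real N - 1)" if "a < N" for a
    using that by (simp add: sum.remove[of _ a] of_nat_diff)
  have "(\<Sum>Q\<in>mlqs n m. ?w Q * ring_rate n m x Q T) =
      (\<Sum>Q\<in>mlqs n m. \<Sum>i<N. ?g (?F (Q, i)))"
  proof (rule sum.cong)
    fix Q assume Q: "Q \<in> mlqs n m"
    have "?w Q * ring_rate n m x Q T =
        (\<Sum>i<N. if ring_transition n N Q i = T then ?w Q * x (bully_projection n m Q i) else 0)"
      by (simp add: ring_rate_def sum_distrib_left flip: sum.inter_filter)
    also have "\<dots> = (\<Sum>i<N. ?g (?F (Q, i)))"
      using mlq_weight_transport[OF Q, of _ "x 1"] by (intro sum.cong refl) (simp add: rate[OF Q] del: lead.simps)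
    finally show "?w Q * ring_rate n m x Q T = (\<Sum>i<N. ?g (?F (Q, i)))" .
  qed simp
  also have "\<dots> = (\<Sum>s\<in>mlqs n m \<times> {..<N}. ?g (?F s))"
    by (simp add: sum.cartesian_product case_prod_unfold)
  also have "\<dots> = (\<Sum>s\<in>mlqs n m \<times> {..<N}. ?g s)"
    by (rule sum.reindex_bij_betw[OF bij_betw_ring])
  also have "\<dots> = (\<Sum>Q\<in>mlqs n m. if Q = T then
      (\<Sum>q<N. ?w Q * (if q = Suc (lead N Q 1) mod N then x 1 else 1)) else 0)"
    by (subst sum.cartesian_product[symmetric]) (auto intro!: sum.cong)
  also have "\<dots> = ?w T * (\<Sum>q<N. if q = Suc (lead N T 1) mod N then x 1 else 1)"
    using T finite_mlqs by (simp add: sum_distrib_left del: lead.simps)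
  also have "\<dots> = ?w T * (\<Sum>i<N. x (bully_projection n m T i))"
    using N_pos by (simp only: rate[OF T]) (simp only: marked lead_less mod_less_divisor)
  finally show ?thesis
    by (simp only: sum_ring_rate[OF T])
qed

section \<open>Connectivity\<close>

text \<open>
  The column (before reduction modulo \<open>N\<close>) at which the particles of row \<open>r\<close> pile up when column 0
  is never rung: the blocks of the rows from the bottom upwards follow one another around the cycle.
\<close>

definition block_start :: "nat \<Rightarrow> nat" where
  "block_start r = (\<Sum>j\<in>{r<..n - 1}. partial_size m j)"

definition packed_row :: "nat \<Rightarrow> nat set" where
  "packed_row r = (\<lambda>k. (block_start r + k) mod N) ` {..<partial_size m r}"

lemma block_start_Suc:
  assumes "r < n - 1"
  shows "block_start r = block_start (Suc r) + partial_size m (Suc r)"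
proof -
  have "{r<..n - 1} = insert (Suc r) {Suc r<..n - 1}"
    using assms by auto
  then show ?thesis
    by (simp add: block_start_def)
qed

lemma partial_size_less_N: "r < n \<Longrightarrow> partial_size m r < N"
  by (rule partial_size_strict_mono) simp_all

lemma in_packed_row_iff:
  assumes "r < n" "k < N"
  shows "(block_start r + k) mod N \<in> packed_row r \<longleftrightarrow> k < partial_size m r"
proof
  assume "(block_start r + k) mod N \<in> packed_row r"
  then obtain j where j: "j < partial_size m r" "(block_start r + k) mod N = (block_start r + j) mod N"
    by (auto simp: packed_row_def)
  then have "k = j"
    using assms partial_size_less_N[OF assms(1)] by (intro add_mod_inject[OF j(2)]) simp_all
  then show "k < partial_size m r"
    using j(1) by simp
qed (simp add: packed_row_def)

lemma card_packed_row:
  assumes "r < n"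
  shows "card (packed_row r) = partial_size m r"
proof -
  have "inj_on (\<lambda>k. (block_start r + k) mod N) {..<partial_size m r}"
    using partial_size_less_N[OF assms] by (auto intro!: inj_onI dest: add_mod_inject)
  then show ?thesis
    by (simp add: packed_row_def card_image)
qed

lemma packed_in_mlqs: "Sigma {1..n - 1} packed_row \<in> mlqs n m"
  and row_packed: "r \<in> {1..n - 1} \<Longrightarrow> row (Sigma {1..n - 1} packed_row) r = packed_row r"
proof -
  show row: "row (Sigma {1..n - 1} packed_row) r = packed_row r" if "r \<in> {1..n - 1}" for r
    using that by (auto simp: row_def)
  show "Sigma {1..n - 1} packed_row \<in> mlqs n m"
    unfolding mlqs_def
  proof (intro CollectI conjI ballI)
    show "Sigma {1..n - 1} packed_row \<subseteq> {1..n - 1} \<times> {..<N}"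
      using N_pos by (auto simp: packed_row_def)
    fix r assume r: "r \<in> {1..n - 1}"
    then have "r < n"
      by auto
    then show "card (row (Sigma {1..n - 1} packed_row) r) = partial_size m r"
      using row[OF r] card_packed_row[of r] by simp
  qed
qed

text \<open>
  A block of particles leaves only one exit column unreachable for paths that do not push its first particle,
  namely the column just after the block: exit \<open>p\<close> is reached through the particle in \<open>p\<close> if column
  \<open>p - 1\<close> is in the block, and through the vacancy in \<open>p - 1\<close> otherwise.
\<close>

lemma ex_ring_pos_above_packed:
  assumes "r \<le> n - 1" and packed: "\<And>j. j \<in> {r<..n - 1} \<Longrightarrow> row Q j = packed_row j"
    and p: "p < N" "p \<noteq> block_start r mod N"
  obtains i where "i < N" "ring_pos n N Q i r = p"
    "\<And>j. j \<in> {r<..n - 1} \<Longrightarrow> row (ring_transition n N Q i) j = row Q j"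
proof -
  have "\<exists>i<N. ring_pos n N Q i r = p \<and>
      (\<forall>j\<in>{r<..n - 1}. row (ring_transition n N Q i) j = row Q j)"
    using assms
  proof (induction r arbitrary: p rule: inc_induct)
    case base
    then show ?case using ring_pos_bottom[of Q p] by (intro exI[of _ p]) simp
  next
    case (step r)
    let ?s = "block_start (Suc r)" and ?A = "row Q (Suc r)"
    have A: "?A = packed_row (Suc r)"
      using step by simp
    have r: "Suc r < n" "Suc r \<in> {1..n - 1}"
      using step by auto
    have size: "0 < partial_size m (Suc r)" "partial_size m (Suc r) < N"
      using partial_size_pos[of "Suc r"] partial_size_less_N[OF r(1)] r by auto
    have left: "left_of N p < N"
      using N_pos by (rule left_of_less)
    then obtain k where k: "k < N" "(?s + k) mod N = left_of N p"
      by (rule ex_offset)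
    have pk: "p = (?s + Suc k) mod N"
      using Suc_left_of_mod[OF step.prems(2)] k(2) by (metis add_Suc_right mod_Suc_eq)
    have "\<exists>p'<N. p' \<noteq> ?s mod N \<and> ring_exit N ?A p' = p \<and> ring_row N ?A p' = ?A"
    proof (cases "k < partial_size m (Suc r)")
      case False
      then have "left_of N p \<notin> ?A"
        using in_packed_row_iff[OF r(1) k(1)] unfolding A k(2) by simp
      moreover have "?s mod N \<in> ?A"
        using in_packed_row_iff[OF r(1), of 0] N_pos size unfolding A by simp
      ultimately have "left_of N p \<noteq> ?s mod N \<and> ring_exit N ?A (left_of N p) = p
          \<and> ring_row N ?A (left_of N p) = ?A"
        using Suc_left_of_mod[OF step.prems(2)] by (auto simp: ring_exit_def ring_row_def)
      then show ?thesis
        using left by blast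
    next
      case True
      have "Suc k \<noteq> partial_size m (Suc r)"
        using pk step.prems(3) block_start_Suc[OF step.hyps(2)] by metis
      then have Suck: "Suc k < partial_size m (Suc r)"
        using True by simp
      have "(?s + Suc k) mod N \<in> packed_row (Suc r)"
        using in_packed_row_iff[OF r(1), of "Suc k"] Suck size by simp
      then have "p \<in> ?A"
        by (simp only: A pk)
      moreover have "left_of N p \<in> ?A"
        using in_packed_row_iff[OF r(1) k(1)] True by (simp only: A k(2))
      moreover have "p \<noteq> ?s mod N"
      proof
        assume "p = ?s mod N"
        then have "(?s + Suc k) mod N = (?s + 0) mod N"
          by (simp only: pk add_0_right)
        then show False
          using add_mod_inject[of ?s "Suc k" N 0] Suck size by linarith
      qed
      ultimately have "p \<noteq> ?s mod N \<and> ring_exit N ?A p = p \<and> ring_row N ?A p = ?A"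
        by (auto simp: ring_exit_def ring_row_def)
      then show ?thesis
        using step.prems(2) by blast
    qed
    then obtain p' where p': "p' < N" "p' \<noteq> ?s mod N" "ring_exit N ?A p' = p" "ring_row N ?A p' = ?A"
      by blast
    have "\<exists>i<N. ring_pos n N Q i (Suc r) = p' \<and>
      (\<forall>j\<in>{Suc r<..n - 1}. row (ring_transition n N Q i) j = row Q j)"
    proof (rule step.IH[OF _ p'(1,2)])
      show "row Q j = packed_row j" if "j \<in> {Suc r<..n - 1}" for j
        using that by (intro step.prems(1)) simp
    qed
    then obtain i where i: "i < N" "ring_pos n N Q i (Suc r) = p'"
      "\<And>j. j \<in> {Suc r<..n - 1} \<Longrightarrow> row (ring_transition n N Q i) j = row Q j"
      by blast
    have "row (ring_transition n N Q i) j = row Q j" if "j \<in> {r<..n - 1}" for j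
    proof (cases "j = Suc r")
      case True
      then show ?thesis
        by (simp only: row_ring_transition[OF r(2)] i(2) p'(4))
    next
      case False
      then show ?thesis
        using that by (intro i(3)) simp
    qed
    moreover have "ring_pos n N Q i r = p"
      using ring_pos_eq_exit[OF step.hyps(2), of Q i] i(2) p'(3) by simp
    ultimately show ?case
      using i(1) by blast
  qed
  then show thesis
    using that by blast
qed

end

text \<open>
  The positions of the particles \<open>A\<close> on the cycle cut open before column \<open>s\<close>. Their sum is the
  potential that decreases while the particles pile up at \<open>s\<close>.
\<close>

definition offsets :: "nat \<Rightarrow> nat \<Rightarrow> nat set \<Rightarrow> nat set" where
  "offsets N s A = {k. k < N \<and> (s + k) mod N \<in> A}"

lemma offsets_image:
  assumes "A \<subseteq> {..<N}"
  shows "(\<lambda>k. (s + k) mod N) ` offsets N s A = A"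
proof
  show "A \<subseteq> (\<lambda>k. (s + k) mod N) ` offsets N s A"
  proof
    fix a assume a: "a \<in> A"
    then obtain k where "k < N" "(s + k) mod N = a"
      using ex_offset[of a N s] assms by auto
    then show "a \<in> (\<lambda>k. (s + k) mod N) ` offsets N s A"
      using a by (auto simp: offsets_def)
  qed
qed (auto simp: offsets_def)

lemma card_offsets:
  assumes "A \<subseteq> {..<N}"
  shows "card (offsets N s A) = card A"
proof -
  have "inj_on (\<lambda>k. (s + k) mod N) (offsets N s A)"
    by (intro inj_onI) (auto simp: offsets_def dest: add_mod_inject)
  then show ?thesis
    using card_image offsets_image[OF assms] by metis
qed

lemma finite_offsets: "finite (offsets N s A)"
  by (simp add: offsets_def)

lemma initial_segment_eq_lessThan_card:
  fixes K :: "nat set"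
  assumes fin: "finite K" and closed: "\<And>k. Suc k \<in> K \<Longrightarrow> k \<in> K"
  shows "K = {..<card K}"
proof -
  have below: "j \<in> K" if "k \<in> K" "j \<le> k" for j k
    using that(2,1) by (induction j rule: inc_induct) (use closed in auto)
  have "k < card K" if "k \<in> K" for k
  proof -
    have "card {..k} \<le> card K"
      using fin below[OF that] by (intro card_mono) auto
    then show ?thesis by simp
  qed
  then show ?thesis
    by (intro card_subset_eq) auto
qed

lemma not_block_imp_ex_mobile:
  assumes A: "A \<subseteq> {..<N}" and "A \<noteq> (\<lambda>k. (s + k) mod N) ` {..<card A}"
  shows "\<exists>k. Suc k < N \<and> (s + Suc k) mod N \<in> A \<and> (s + k) mod N \<notin> A"
proof (rule ccontr)
  assume "\<not> ?thesis"
  then have mobile: "Suc k < N \<Longrightarrow> (s + Suc k) mod N \<in> A \<Longrightarrow> (s + k) mod N \<in> A" for k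
    by blast
  have "k \<in> offsets N s A" if "Suc k \<in> offsets N s A" for k
    using that mobile[of k] by (auto simp: offsets_def)
  then have "offsets N s A = {..<card A}"
    using initial_segment_eq_lessThan_card[OF finite_offsets, of N s A] card_offsets[OF A] by auto
  then show False
    using assms(2) offsets_image[OF A, of s] by simp
qed

lemma sum_offsets_ring_row:
  assumes k: "Suc k < N" "(s + Suc k) mod N \<in> A" "(s + k) mod N \<notin> A"
  shows "\<Sum>(offsets N s (ring_row N A ((s + Suc k) mod N))) < \<Sum>(offsets N s A)"
proof -
  let ?K = "offsets N s A"
  have left: "left_of N ((s + Suc k) mod N) = (s + k) mod N"
    using left_of_Suc_mod[of "(s + k) mod N" N] k(1) by (simp add: mod_Suc_eq)
  have "offsets N s (ring_row N A ((s + Suc k) mod N)) = insert k (?K - {Suc k})"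
    using k by (auto simp: offsets_def ring_row_def left simp del: add_Suc_right dest: add_mod_inject)
  moreover have "Suc k \<in> ?K" "k \<notin> ?K"
    using k by (auto simp: offsets_def)
  ultimately show ?thesis
    using sum.remove[OF finite_offsets \<open>Suc k \<in> ?K\<close>, of "\<lambda>k. k"] by (simp add: finite_offsets)
qed

context single_first_class
begin

text \<open>
  The rows are packed from the bottom upwards. A row above packed ones is not yet packed only if one of its
  particles, outside the first column of its block, has a vacancy to the left. This particle can be
  rung without disturbing the rows below, which lowers the sum of the offsets.
\<close>

lemma constant_if_ring_invariant:
  fixes h :: "mlq \<Rightarrow> real"
  assumes inv: "\<And>Q i. Q \<in> mlqs n m \<Longrightarrow> i < N \<Longrightarrow> h Q = h (ring_transition n N Q i)"
    and Q: "Q \<in> mlqs n m"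
  shows "h Q = h (Sigma {1..n - 1} packed_row)"
proof -
  have "h Q = h (Sigma {1..n - 1} packed_row)"
    if "r \<le> n - 1" "Q \<in> mlqs n m" "\<And>j. j \<in> {r<..n - 1} \<Longrightarrow> row Q j = packed_row j" for r Q
    using that
  proof (induction r arbitrary: Q)
    case 0
    have "Q = Sigma {1..n - 1} packed_row"
    proof (intro mlq_eqI packed_in_mlqs "0.prems"(2))
      fix r assume r: "r \<in> {1..n - 1}"
      then show "row Q r = row (Sigma {1..n - 1} packed_row) r"
        unfolding row_packed[OF r] by (intro "0.prems"(3)) auto
    qed
    then show ?case by simp
  next
    case (Suc r)
    let ?s = "block_start (Suc r)"
    show ?case
      using Suc.prems
    proof (induction "\<Sum>(offsets N ?s (row Q (Suc r)))" arbitrary: Q rule: less_induct)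
      case less
      show ?case
      proof (cases "row Q (Suc r) = packed_row (Suc r)")
        case True
        show ?thesis
        proof (rule Suc.IH)
          show "row Q j = packed_row j" if "j \<in> {r<..n - 1}" for j
            using that True less.prems(3)[of j] by (cases "j = Suc r") auto
        qed (use less.prems in auto)
      next
        case False
        then have "row Q (Suc r) \<noteq> (\<lambda>k. (?s + k) mod N) ` {..<card (row Q (Suc r))}"
          using card_row[OF less.prems(2), of "Suc r"] less.prems(1) by (simp add: packed_row_def)
        then obtain k where k: "Suc k < N" "(?s + Suc k) mod N \<in> row Q (Suc r)"
          "(?s + k) mod N \<notin> row Q (Suc r)"
          using not_block_imp_ex_mobile[OF row_subset[OF less.prems(2)]] by blast
        have "(?s + Suc k) mod N \<noteq> ?s mod N"
          using add_mod_inject[of ?s "Suc k" N 0] k(1) by auto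
        then obtain i where i: "i < N" "ring_pos n N Q i (Suc r) = (?s + Suc k) mod N"
          "\<And>j. j \<in> {Suc r<..n - 1} \<Longrightarrow> row (ring_transition n N Q i) j = row Q j"
          using ex_ring_pos_above_packed[OF less.prems(1,3), of "(?s + Suc k) mod N"] N_pos by auto
        have "h (ring_transition n N Q i) = h (Sigma {1..n - 1} packed_row)"
        proof (rule less.hyps)
          show "\<Sum>(offsets N ?s (row (ring_transition n N Q i) (Suc r))) < \<Sum>(offsets N ?s (row Q (Suc r)))"
            using sum_offsets_ring_row[OF k] row_ring_transition[of "Suc r" Q i] less.prems(1) i(2) by simp
        qed (use less.prems i(3) ring_transition_in_mlqs in auto)
        then show ?thesis
          using inv[OF less.prems(2) i(1)] by simp
      qed
    qed
  qed
  from this[of "n - 1" Q] show ?thesis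
    using Q by simp
qed

lemma ring_rate_pos:
  assumes x: "\<And>j. j \<in> {1..n} \<Longrightarrow> 0 < x j" and Q: "Q \<in> mlqs n m" and "i < N"
  shows "0 < ring_rate n m x Q (ring_transition n N Q i)"
  unfolding ring_rate_def using bully_projection_range[OF Q] x assms(3) by (intro sum_pos) auto

lemma ring_rate_nonneg:
  assumes x: "\<And>j. j \<in> {1..n} \<Longrightarrow> 0 < x j" and Q: "Q \<in> mlqs n m"
  shows "0 \<le> ring_rate n m x Q Q'"
  unfolding ring_rate_def using bully_projection_range[OF Q] x
  by (intro sum_nonneg) (meson less_imp_le)

end

theorem theorem4p1:
  fixes n :: nat and m :: "nat \<Rightarrow> nat" and x :: "nat \<Rightarrow> real" and p :: "mlq \<Rightarrow> real"
  assumes "2 \<le> n"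
    and "\<And>j. j \<in> {1..n} \<Longrightarrow> 0 < m j"
    and "m 1 = 1"
    and "0 < x 1"
    and "\<And>j. j \<in> {2..n} \<Longrightarrow> x j = 1"
  shows "stationary_distribution (mlqs n m) (ring_rate n m x) p \<longleftrightarrow>
         (\<forall>Q \<in> mlqs n m. p Q = x 1 ^ (v_one n m - z_one n m Q) / partition_function n m (x 1))"
proof -
  interpret single_first_class n m
    using assms by unfold_locales
  have x: "0 < x j" if "j \<in> {1..n}" for j
    using assms(4,5) that by (cases "j = 1") auto
  have "stationary_distribution (mlqs n m) (ring_rate n m x) p \<longleftrightarrow>
      (\<forall>Q\<in>mlqs n m. p Q = mlq_weight n m (x 1) Q / (\<Sum>Q\<in>mlqs n m. mlq_weight n m (x 1) Q))"
  proof (rule stationary_distribution_iff_normalized)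
    show "mlqs n m \<noteq> {}"
      using packed_in_mlqs by blast
    show "0 < mlq_weight n m (x 1) Q" for Q
      using assms(4) by (simp add: mlq_weight_def)
    show "\<exists>c. \<forall>Q\<in>mlqs n m. h Q = c"
      if h: "\<And>Q Q'. Q \<in> mlqs n m \<Longrightarrow> Q' \<in> mlqs n m \<Longrightarrow> 0 < ring_rate n m x Q Q' \<Longrightarrow> h Q = h Q'"
      for h :: "mlq \<Rightarrow> real"
      using constant_if_ring_invariant[of h] h ring_rate_pos[of x] x ring_transition_in_mlqs by blast
  qed (use finite_mlqs mlq_weight_balance assms(5) ring_rate_nonneg x in auto)
  then show ?thesis
    by (simp only: mlq_weight_def partition_function_def)
qed

end
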